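(* Let $\{k_n\}_{n=0}^\infty$ be a building sequence of the family of random multi-hooking networks $\{G_n\}_{n\ge 1}$ grown from a seed $G_0$ with hook $h$. For $n\ge 1$, the conditional diameter $\widetilde{\mathcal{D}}_n=\mathcal{D}_n\mid G_{n-1},\mathbb{L}_{n-1}$ of the graph $G_n$ of age $n$, given $G_{n-1}$ and the set $\mathbb{L}_{n-1}$ of latches chosen in it, is $$\widetilde{\mathcal{D}}_n=\max\Big\{\mathcal{D}_{n-1},\;\big(2C_0(h)+q_{n-1}\big)\,\mathbb{I}_{\{k_{n-1}>1\}},\;C_0(h)+\alpha_{n-1}\Big\}.$$
   Context: Seed. $G_0$ is a connected finite graph (loops and multiple edges are allowed) with $\tau_0\ge 2$ vertices, one of which is designated as the hook $h$. Building sequence. A sequence of integers $\{k_n\}_{n=0}^\infty$ with $k_n\ge 1$ is a building sequence (for a seed of order $\tau_0$) if: (i) $k_n\le \tau_0+(\tau_0-1)\sum_{i=0}^{n-1}k_i$ for all $n\ge 0$; (ii) the limit $a:=\lim_{n\to\infty} k_n/\sum_{i=0}^n k_i$ exists in $[0,1]$; (iii) the limit $b:=\lim_{n\to\infty}\tau_0/k_n\ge 0$ exists. Random multi-hooking network. For $n\ge 1$, given $G_{n-1}=(V_{n-1},\mathcal{E}_{n-1})$, a set $\mathbb{L}_{n-1}=\{\ell_1,\ldots,\ell_{k_{n-1}}\}$ of $k_{n-1}$ distinct vertices of $G_{n-1}$, called latches, is chosen uniformly at random among all subsets of $V_{n-1}$ of size $k_{n-1}$ (given the whole past). For each latch a fresh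 copy of the seed is taken and its hook is fused (identified) with the latch; distinct latches receive distinct copies. The result is $G_n$. Notation. The distance $d$ between two vertices is the number of edges on a shortest path joining them. $C_m(u)$ is the eccentricity of a vertex $u$ in $G_m$, i.e., the maximum distance in $G_m$ from $u$ to a vertex of $G_m$. $\mathcal{D}_m$ is the diameter of $G_m$, i.e., the maximum eccentricity over its vertices. When $k_m>1$, $q_m=\max_{\ell,\tilde\ell\in\mathbb{L}_m}d(\ell,\tilde\ell)$ is the maximum distance in $G_m$ between two latches of $\mathbb{L}_m$. $\alpha_m=\max_{\ell\in\mathbb{L}_m}C_m(\ell)$ is the maximum eccentricity in $G_m$ of a latch of $\mathbb{L}_m$. $\mathbb{I}_{\{k_{n-1}>1\}}$ is $1$ if $k_{n-1}>1$ and $0$ otherwise; the term containing it is $0$ when $k_{n-1}=1$ (where $q_{n-1}$ is not defined). *)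

theory Defs
  imports "HOL-Probability.Probability_Mass_Function"
begin

section \<open>Undirected multigraphs\<close>

text \<open>An edge is mapped to the set of its endpoints, a loop to a singleton.\<close>

record ('v, 'e) mgraph =
  verts :: "'v set"
  edges :: "'e set"
  ends :: "'e \<Rightarrow> 'v set"

definition finite_mgraph :: "('v, 'e) mgraph \<Rightarrow> bool" where
  "finite_mgraph G \<longleftrightarrow> finite (verts G) \<and> finite (edges G) \<and>
     (\<forall>e\<in>edges G. ends G e \<subseteq> verts G \<and> card (ends G e) \<in> {1, 2})"

definition adjacent :: "('v, 'e) mgraph \<Rightarrow> 'v \<Rightarrow> 'v \<Rightarrow> bool" where
  "adjacent G u v \<longleftrightarrow> (\<exists>e\<in>edges G. ends G e = {u, v})"

text \<open>Paths are represented by their vertex sequence, so that the path \<open>p\<close> has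
  \<open>length p - 1\<close> edges.\<close>

definition is_path :: "('v, 'e) mgraph \<Rightarrow> 'v \<Rightarrow> 'v list \<Rightarrow> 'v \<Rightarrow> bool" where
  "is_path G u p v \<longleftrightarrow> p \<noteq> [] \<and> hd p = u \<and> last p = v \<and> set p \<subseteq> verts G \<and>
     distinct p \<and> successively (adjacent G) p"

definition connected_mgraph :: "('v, 'e) mgraph \<Rightarrow> bool" where
  "connected_mgraph G \<longleftrightarrow> verts G \<noteq> {} \<and>
     (\<forall>u\<in>verts G. \<forall>v\<in>verts G. \<exists>p. is_path G u p v)"

definition gdist :: "('v, 'e) mgraph \<Rightarrow> 'v \<Rightarrow> 'v \<Rightarrow> nat" where
  "gdist G u v = (LEAST d. \<exists>p. is_path G u p v \<and> d = length p - 1)"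

definition eccentricity :: "('v, 'e) mgraph \<Rightarrow> 'v \<Rightarrow> nat" where
  "eccentricity G u = (MAX v\<in>verts G. gdist G u v)"

definition graph_diameter :: "('v, 'e) mgraph \<Rightarrow> nat" where
  "graph_diameter G = (MAX u\<in>verts G. eccentricity G u)"

section \<open>Seeds and building sequences\<close>

definition seed :: "('v, 'e) mgraph \<Rightarrow> 'v \<Rightarrow> bool" where
  "seed S h \<longleftrightarrow> finite_mgraph S \<and> connected_mgraph S \<and> card (verts S) \<ge> 2 \<and> h \<in> verts S"

definition building_sequence :: "nat \<Rightarrow> (nat \<Rightarrow> nat) \<Rightarrow> bool" where
  "building_sequence \<tau> k \<longleftrightarrow>
     (\<forall>n. k n \<ge> 1) \<and>
     (\<forall>n. k n \<le> \<tau> + (\<tau> - 1) * (\<Sum>i<n. k i)) \<and>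
     (\<exists>a\<in>{0..1::real}. (\<lambda>n. real (k n) / real (\<Sum>i\<le>n. k i)) \<longlonglongrightarrow> a) \<and>
     (\<exists>b\<ge>0::real. (\<lambda>n. real \<tau> / real (k n)) \<longlonglongrightarrow> b)"

section \<open>Hooking\<close>

text \<open>The vertex \<open>Copy_Vertex n l v\<close> is the vertex \<open>v\<close> (other than the hook) of the fresh copy of
  the seed that is fused to the latch \<open>l\<close> in the step producing the graph of age \<open>n\<close>; similarly
  for edges. The age makes copies hooked to the same latch in different steps disjoint.\<close>

datatype 'v vertex = Seed_Vertex 'v | Copy_Vertex nat "'v vertex" 'v

datatype ('v, 'e) edge = Seed_Edge 'e | Copy_Edge nat "'v vertex" 'e

type_synonym ('v, 'e) network = "('v vertex, ('v, 'e) edge) mgraph"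

definition initial_network :: "('v, 'e) mgraph \<Rightarrow> ('v, 'e) network" where
  "initial_network S =
     \<lparr> verts = Seed_Vertex ` verts S,
       edges = Seed_Edge ` edges S,
       ends = (\<lambda>e. case e of Seed_Edge e' \<Rightarrow> Seed_Vertex ` ends S e' | Copy_Edge _ _ _ \<Rightarrow> {}) \<rparr>"

definition fuse :: "'v \<Rightarrow> nat \<Rightarrow> 'v vertex \<Rightarrow> 'v \<Rightarrow> 'v vertex" where
  "fuse h n l v = (if v = h then l else Copy_Vertex n l v)"

definition hook_step ::
  "('v, 'e) mgraph \<Rightarrow> 'v \<Rightarrow> nat \<Rightarrow> ('v, 'e) network \<Rightarrow> 'v vertex set \<Rightarrow> ('v, 'e) network" where
  "hook_step S h n G L =
     \<lparr> verts = verts G \<union> (\<Union>l\<in>L. fuse h n l ` verts S),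
       edges = edges G \<union> (\<Union>l\<in>L. Copy_Edge n l ` edges S),
       ends = (\<lambda>e. case e of
           Seed_Edge _ \<Rightarrow> ends G e
         | Copy_Edge m l e' \<Rightarrow> if m = n \<and> l \<in> L then fuse h n l ` ends S e' else ends G e) \<rparr>"

section \<open>The random network\<close>

text \<open>The network of age \<open>n\<close> is determined by the sets of latches chosen so far. These are
  listed with the most recent one first: \<open>[L\<^sub>n\<^sub>-\<^sub>1, \<dots>, L\<^sub>0]\<close>.\<close>

primrec grow :: "('v, 'e) mgraph \<Rightarrow> 'v \<Rightarrow> 'v vertex set list \<Rightarrow> ('v, 'e) network" where
  "grow S h [] = initial_network S"
| "grow S h (L # Ls) = hook_step S h (Suc (length Ls)) (grow S h Ls) L"

text \<open>The joint law of \<open>[L\<^sub>n\<^sub>-\<^sub>1, \<dots>, L\<^sub>0]\<close>. The upper bound on \<open>k n\<close> in \<open>building_sequence\<close> ensures that the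
  set from which \<open>L\<^sub>n\<close> is drawn is nonempty, as \<open>pmf_of_set\<close> requires.\<close>

primrec latch_history ::
  "('v, 'e) mgraph \<Rightarrow> 'v \<Rightarrow> (nat \<Rightarrow> nat) \<Rightarrow> nat \<Rightarrow> 'v vertex set list pmf" where
  "latch_history S h k 0 = return_pmf []"
| "latch_history S h k (Suc n) =
     bind_pmf (latch_history S h k n) (\<lambda>Ls.
       map_pmf (\<lambda>L. L # Ls) (pmf_of_set {L. L \<subseteq> verts (grow S h Ls) \<and> card L = k n}))"

text \<open>The joint law of the pair consisting of the network of age \<open>n - 1\<close> and the set of latches
  chosen in it, for \<open>n \<ge> 1\<close>.\<close>

definition past_law ::
  "('v, 'e) mgraph \<Rightarrow> 'v \<Rightarrow> (nat \<Rightarrow> nat) \<Rightarrow> nat \<Rightarrow> (('v, 'e) network \<times> 'v vertex set) pmf" where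
  "past_law S h k n = map_pmf (\<lambda>Ls. (grow S h (tl Ls), hd Ls)) (latch_history S h k n)"

text \<open>The conditional law of the diameter at age \<open>n \<ge> 1\<close>, given that the network of age \<open>n - 1\<close>
  is \<open>G\<close> and that the set of latches chosen in it is \<open>L\<close>. It is meaningful for \<open>(G, L)\<close> in the
  support of \<open>past_law S h k n\<close>.\<close>

definition conditional_diameter ::
  "('v, 'e) mgraph \<Rightarrow> 'v \<Rightarrow> (nat \<Rightarrow> nat) \<Rightarrow> nat \<Rightarrow> ('v, 'e) network \<Rightarrow> 'v vertex set \<Rightarrow> nat pmf" where
  "conditional_diameter S h k n G L =
     map_pmf (\<lambda>Ls. graph_diameter (grow S h Ls))
       (cond_pmf (latch_history S h k n) {Ls. grow S h (tl Ls) = G \<and> hd Ls = L})"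

definition latch_distance :: "('v, 'e) mgraph \<Rightarrow> 'v set \<Rightarrow> nat" where
  "latch_distance G L = Max {gdist G l l' | l l'. l \<in> L \<and> l' \<in> L}"

definition latch_eccentricity :: "('v, 'e) mgraph \<Rightarrow> 'v set \<Rightarrow> nat" where
  "latch_eccentricity G L = (MAX l\<in>L. eccentricity G l)"

end

theory Submission imports Defs begin

text \<open>Hooking does not change distances between old vertices, and every shortest path that enters
  or leaves a copy of the seed does so through its latch. Hence the distance from an old vertex to
  the vertex \<open>v\<close> of the copy at \<open>l\<close> is the distance to \<open>l\<close> plus the one from the hook to \<open>v\<close>, and
  similarly for two different copies. The lower bounds come from 1-Lipschitz functions: the distance
  to a fixed old vertex after retracting each copy to its latch, plus or minus the depth in the
  copy. Distances within one copy are absorbed by the old diameter, because the seed itself remains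
  isometrically embedded in the network.\<close>

section \<open>Distances in connected multigraphs\<close>

lemma adjacent_sym: "adjacent G u v \<Longrightarrow> adjacent G v u"
  by (simp add: adjacent_def insert_commute)

lemma relpowp_adjacent_sym: "(adjacent G ^^ d) u v \<Longrightarrow> (adjacent G ^^ d) v u"
proof (induction d arbitrary: v)
  case (Suc d)
  then obtain x where "(adjacent G ^^ d) u x" "adjacent G x v" by auto
  then show ?case using Suc.IH adjacent_sym by (metis relpowp_Suc_I2)
qed simp

lemma relpowp_map:
  assumes "\<And>x y. R x y \<Longrightarrow> Q (f x) (f y)" and "(R ^^ d) u v"
  shows "(Q ^^ d) (f u) (f v)"
  using assms(2)
proof (induction d arbitrary: v)
  case (Suc d)
  then show ?case using assms(1) by (auto intro: relpowp_Suc_I)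
qed simp

text \<open>Source of the lower bounds on distances: a potential that rises by at most 1 per edge
  bounds the length of every walk from below.\<close>

lemma relpowp_lipschitz:
  fixes \<phi> :: "'a \<Rightarrow> int"
  assumes "\<And>x y. R x y \<Longrightarrow> \<phi> y \<le> \<phi> x + 1" and "(R ^^ d) u v"
  shows "\<phi> v \<le> \<phi> u + int d"
  using assms(2)
proof (induction d arbitrary: v)
  case (Suc d)
  then obtain x where "(R ^^ d) u x" "R x v" by auto
  then show ?case using Suc.IH[of x] assms(1)[of x v] by simp
qed simp

lemma successively_imp_relpowp:
  "p \<noteq> [] \<Longrightarrow> successively R p \<Longrightarrow> (R ^^ (length p - 1)) (hd p) (last p)"
proof (induction p rule: induct_list012)
  case (3 x y zs)
  then have "(R ^^ length zs) y (last (y # zs))" "R x y" by simp_all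
  then show ?case using relpowp_Suc_I2[of R x y "length zs" "last (y # zs)"] by simp
qed simp_all

text \<open>\<open>is_path\<close> demands distinct vertices, so when the next vertex of the walk
  already lies on the path, the path is cut back to that vertex. Afterwards distances can be handled
  through walks, which compose freely.\<close>

lemma relpowp_imp_path:
  assumes G: "finite_mgraph G" and u: "u \<in> verts G" and "(adjacent G ^^ d) u v"
  shows "\<exists>p. is_path G u p v \<and> length p - 1 \<le> d"
  using assms(3)
proof (induction d arbitrary: v)
  case 0
  then show ?case using u by (intro exI[of _ "[u]"]) (simp add: is_path_def)
next
  case (Suc d)
  then obtain x where x: "(adjacent G ^^ d) u x" "adjacent G x v" by auto
  obtain p where p: "is_path G u p x" "length p - 1 \<le> d" using Suc.IH x(1) by blast
  have v: "v \<in> verts G" using x(2) G by (auto simp: adjacent_def finite_mgraph_def)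
  show ?case
  proof (cases "v \<in> set p")
    case True
    then obtain p1 p2 where p12: "p = p1 @ v # p2" by (auto simp: in_set_conv_decomp)
    have "is_path G u (p1 @ [v]) v"
      using p(1) unfolding p12 is_path_def
      by (auto simp: successively_append_iff successively_Cons hd_append)
    moreover have "length (p1 @ [v]) - 1 \<le> Suc d" using p(2) p12 by simp
    ultimately show ?thesis by blast
  next
    case False
    have "is_path G u (p @ [v]) v"
      using p(1) False x(2) v unfolding is_path_def by (auto simp: successively_append_iff)
    moreover have "length (p @ [v]) - 1 \<le> Suc d" using p(2) by simp
    ultimately show ?thesis by blast
  qed
qed

lemma gdist_le:
  assumes "finite_mgraph G" "u \<in> verts G" "(adjacent G ^^ d) u v"
  shows "gdist G u v \<le> d"
proof -
  obtain p where "is_path G u p v" "length p - 1 \<le> d" using relpowp_imp_path[OF assms] by blast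
  moreover then have "gdist G u v \<le> length p - 1" unfolding gdist_def by (intro Least_le) blast
  ultimately show ?thesis by simp
qed

section \<open>The metric of a finite connected multigraph\<close>

locale connected_graph =
  fixes G :: "('v, 'e) mgraph"
  assumes finite_mgraph: "finite_mgraph G" and connected_mgraph: "connected_mgraph G"
begin

lemma finite_verts [simp]: "finite (verts G)"
  using finite_mgraph by (simp add: finite_mgraph_def)

lemma verts_nonempty [simp]: "verts G \<noteq> {}"
  using connected_mgraph by (simp add: connected_mgraph_def)

lemma adjacent_verts: "adjacent G u v \<Longrightarrow> u \<in> verts G \<and> v \<in> verts G"
  using finite_mgraph by (auto simp: adjacent_def finite_mgraph_def)

lemma relpowp_gdist:
  assumes "u \<in> verts G" "v \<in> verts G"
  shows "(adjacent G ^^ gdist G u v) u v"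
proof -
  have "\<exists>d p. is_path G u p v \<and> d = length p - 1"
    using assms connected_mgraph by (simp add: connected_mgraph_def)
  then obtain p where "is_path G u p v" "gdist G u v = length p - 1"
    unfolding gdist_def by (rule LeastI_ex[THEN exE]) blast
  then show ?thesis using successively_imp_relpowp[of p "adjacent G"] by (simp add: is_path_def)
qed

lemma gdist_refl: "u \<in> verts G \<Longrightarrow> gdist G u u = 0"
  using gdist_le[OF finite_mgraph, of u 0 u] by simp

lemma gdist_adjacent: "adjacent G u v \<Longrightarrow> gdist G u v \<le> 1"
  using gdist_le[OF finite_mgraph, of u 1 v] adjacent_verts by auto

lemma gdist_triangle:
  assumes "u \<in> verts G" "v \<in> verts G" "w \<in> verts G"
  shows "gdist G u w \<le> gdist G u v + gdist G v w"
  using assms by (intro gdist_le finite_mgraph) (auto simp: relpowp_add intro: relpowp_gdist)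

lemma gdist_sym:
  assumes "u \<in> verts G" "v \<in> verts G"
  shows "gdist G u v = gdist G v u"
  using gdist_le[OF finite_mgraph assms(1) relpowp_adjacent_sym[OF relpowp_gdist[OF assms(2,1)]]]
    gdist_le[OF finite_mgraph assms(2) relpowp_adjacent_sym[OF relpowp_gdist[OF assms]]] by simp

lemma gdist_lipschitz:
  fixes \<phi> :: "'v \<Rightarrow> int"
  assumes "\<And>x y. adjacent G x y \<Longrightarrow> \<phi> y \<le> \<phi> x + 1" "u \<in> verts G" "v \<in> verts G"
  shows "\<phi> v \<le> \<phi> u + int (gdist G u v)"
  using assms relpowp_gdist by (intro relpowp_lipschitz)

text \<open>A homomorphism carries a shortest walk to a walk of the same length. This serves the
  inclusion of the old network, the embedding of each copy, and the removal of labels from the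
  initial network.\<close>

lemma gdist_hom_le:
  assumes "finite_mgraph H" "f ` verts G \<subseteq> verts H"
    and "\<And>x y. adjacent G x y \<Longrightarrow> adjacent H (f x) (f y)" "u \<in> verts G" "v \<in> verts G"
  shows "gdist H (f u) (f v) \<le> gdist G u v"
proof (rule gdist_le)
  show "(adjacent H ^^ gdist G u v) (f u) (f v)"
    using relpowp_map[of "adjacent G" "adjacent H" f] assms relpowp_gdist by blast
qed (use assms in auto)

lemma gdist_edge_diff:
  assumes "adjacent G x y" "u \<in> verts G"
  shows "\<bar>int (gdist G u y) - int (gdist G u x)\<bar> \<le> 1"
proof -
  have xy: "x \<in> verts G" "y \<in> verts G" using adjacent_verts[OF assms(1)] by auto
  show ?thesis
    using gdist_triangle[OF assms(2) xy] gdist_triangle[OF assms(2) xy(2,1)]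
      gdist_adjacent[OF assms(1)] gdist_sym[OF xy] by linarith
qed

lemma gdist_le_eccentricity: "v \<in> verts G \<Longrightarrow> gdist G u v \<le> eccentricity G u"
  unfolding eccentricity_def by (rule Max_ge) auto

lemma eccentricity_attained: "\<exists>v\<in>verts G. eccentricity G u = gdist G u v"
proof -
  have "eccentricity G u \<in> gdist G u ` verts G"
    unfolding eccentricity_def by (rule Max_in) auto
  then show ?thesis by auto
qed

lemma gdist_le_diameter:
  assumes "u \<in> verts G" "v \<in> verts G"
  shows "gdist G u v \<le> graph_diameter G"
proof -
  have "eccentricity G u \<le> graph_diameter G"
    unfolding graph_diameter_def using assms(1) by (intro Max_ge) auto
  then show ?thesis using gdist_le_eccentricity[OF assms(2), of u] by simp
qed

lemma diameter_le:
  assumes "\<And>u v. u \<in> verts G \<Longrightarrow> v \<in> verts G \<Longrightarrow> gdist G u v \<le> d"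
  shows "graph_diameter G \<le> d"
  using assms unfolding graph_diameter_def eccentricity_def by simp

end

lemma connected_graphI:
  assumes "finite_mgraph G" "verts G \<noteq> {}"
    and "\<And>u v. u \<in> verts G \<Longrightarrow> v \<in> verts G \<Longrightarrow> (adjacent G)\<^sup>*\<^sup>* u v"
  shows "connected_graph G"
proof
  have "\<exists>p. is_path G u p v" if uv: "u \<in> verts G" "v \<in> verts G" for u v
  proof -
    obtain d where "(adjacent G ^^ d) u v" using rtranclp_imp_relpowp[OF assms(3)[OF uv]] by blast
    then show ?thesis using relpowp_imp_path[OF assms(1) uv(1)] by blast
  qed
  then show "connected_mgraph G" using assms(2) by (simp add: connected_mgraph_def)
qed (rule assms(1))

section \<open>One hooking step\<close>

text \<open>The number of the step that created the vertex. Bounds on it show that the vertices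
  added in a later step are fresh.\<close>

primrec vertex_age :: "'v vertex \<Rightarrow> nat" where
  "vertex_age (Seed_Vertex v) = 0"
| "vertex_age (Copy_Vertex m l v) = m"

primrec edge_age :: "('v, 'e) edge \<Rightarrow> nat" where
  "edge_age (Seed_Edge e) = 0"
| "edge_age (Copy_Edge m l e) = m"

locale hooking =
  S: connected_graph S + G: connected_graph G
  for S :: "('v, 'e) mgraph" and G :: "('v, 'e) network" +
  fixes h :: 'v and n :: nat and L :: "'v vertex set"
  assumes hook: "h \<in> verts S"
    and latches: "L \<subseteq> verts G"
    and vertex_age: "x \<in> verts G \<Longrightarrow> vertex_age x < n"
    and edge_age: "e \<in> edges G \<Longrightarrow> edge_age e < n"
begin

abbreviation H :: "('v, 'e) network" where "H \<equiv> hook_step S h n G L"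

text \<open>Together with \<open>depth\<close> this gives coordinates on the new network: the old
  vertex at which a copy hangs, and the distance from the hook inside that copy. Copies from earlier
  steps count as old.\<close>

definition retract :: "'v vertex \<Rightarrow> 'v vertex" where
  "retract x = (case x of Seed_Vertex v \<Rightarrow> x | Copy_Vertex m l v \<Rightarrow> if m = n then l else x)"

definition depth :: "'v vertex \<Rightarrow> nat" where
  "depth x = (case x of Seed_Vertex v \<Rightarrow> 0
     | Copy_Vertex m l v \<Rightarrow> if m = n then gdist S h v else 0)"

lemma retract_old [simp]: "x \<in> verts G \<Longrightarrow> retract x = x"
  using vertex_age[of x] by (cases x) (auto simp: retract_def)

lemma depth_old [simp]: "x \<in> verts G \<Longrightarrow> depth x = 0"
  using vertex_age[of x] by (cases x) (auto simp: depth_def)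

lemma latch_verts: "l \<in> L \<Longrightarrow> l \<in> verts G"
  using latches by auto

lemma retract_fuse [simp]: "l \<in> L \<Longrightarrow> retract (fuse h n l v) = l"
  using latch_verts by (auto simp: fuse_def) (simp add: retract_def)

lemma depth_fuse [simp]: "l \<in> L \<Longrightarrow> depth (fuse h n l v) = gdist S h v"
  using latch_verts S.gdist_refl[OF hook] by (auto simp: fuse_def) (simp add: depth_def)

lemma verts_H: "verts H = verts G \<union> (\<Union>l\<in>L. fuse h n l ` verts S)"
  by (simp add: hook_step_def)

lemma verts_H_cases:
  assumes "x \<in> verts H"
  obtains "x \<in> verts G" | l v where "l \<in> L" "v \<in> verts S" "x = fuse h n l v"
  using assms by (auto simp: verts_H)

lemma finite_L: "finite L"
  using finite_subset[OF latches G.finite_verts] .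

text \<open>Each latch contributes all vertices of the seed except the hook, which is identified
  with the latch. The resulting count matches the growth bound in
  \<open>building_sequence\<close>.\<close>

lemma card_verts_H: "card (verts H) = card (verts G) + card L * (card (verts S) - 1)"
proof -
  let ?C = "(\<lambda>(l, v). Copy_Vertex n l v) ` (L \<times> (verts S - {h}))"
  have "verts H = verts G \<union> ?C"
    unfolding verts_H fuse_def using latches hook by (force simp: image_iff)
  moreover have "verts G \<inter> ?C = {}" using vertex_age by fastforce
  moreover have "card ?C = card L * (card (verts S) - 1)"
    using hook by (subst card_image) (auto simp: inj_on_def card_cartesian_product)
  ultimately show ?thesis by (simp add: card_Un_disjoint finite_L)
qed

lemma ends_old: "e \<in> edges G \<Longrightarrow> ends H e = ends G e"
  using edge_age[of e] by (cases e) (auto simp: hook_step_def)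

lemma ends_copy: "l \<in> L \<Longrightarrow> ends H (Copy_Edge n l e) = fuse h n l ` ends S e"
  by (simp add: hook_step_def)

lemma edges_H: "edges H = edges G \<union> (\<Union>l\<in>L. Copy_Edge n l ` edges S)"
  by (simp add: hook_step_def)

lemma seed_edge_ends:
  assumes "e \<in> edges S"
  obtains a b where "ends S e = {a, b}" "a \<in> verts S" "b \<in> verts S"
proof -
  have e: "ends S e \<subseteq> verts S" "card (ends S e) = 1 \<or> card (ends S e) = 2"
    using assms S.finite_mgraph by (auto simp: finite_mgraph_def)
  from e(2) obtain a b where "ends S e = {a, b}"
    by (metis card_1_singletonE card_2_iff insert_absorb2)
  then show thesis using that e(1) by auto
qed

lemma finite_mgraph_H: "finite_mgraph H"
proof -
  have "ends H e \<subseteq> verts H \<and> card (ends H e) \<in> {1, 2}" if e: "e \<in> edges H" for e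
  proof (cases "e \<in> edges G")
    case True
    then show ?thesis
      using G.finite_mgraph by (auto simp: ends_old finite_mgraph_def verts_H)
  next
    case False
    then obtain l e' where e': "l \<in> L" "e' \<in> edges S" "e = Copy_Edge n l e'"
      using e by (auto simp: edges_H)
    obtain a b where "ends S e' = {a, b}" "a \<in> verts S" "b \<in> verts S"
      using seed_edge_ends[OF e'(2)] .
    then show ?thesis using e' by (auto simp: ends_copy verts_H card_insert_if)
  qed
  moreover have "finite (edges G)" "finite (edges S)"
    using G.finite_mgraph S.finite_mgraph by (auto simp: finite_mgraph_def)
  ultimately show ?thesis
    by (auto simp: finite_mgraph_def verts_H edges_H finite_L)
qed

lemma adjacent_old: "adjacent G x y \<Longrightarrow> adjacent H x y"
  unfolding adjacent_def using ends_old by (auto simp: edges_H)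

lemma adjacent_fuse: "l \<in> L \<Longrightarrow> adjacent S a b \<Longrightarrow> adjacent H (fuse h n l a) (fuse h n l b)"
  unfolding adjacent_def using ends_copy by (fastforce simp: edges_H)

text \<open>No edge joins two copies or leaves a copy except at its latch, so a potential can be
  checked separately on old edges and on seed edges.\<close>

lemma adjacent_H_cases:
  assumes "adjacent H x y"
  obtains "adjacent G x y"
  | l a b where "l \<in> L" "adjacent S a b" "x = fuse h n l a" "y = fuse h n l b"
proof -
  obtain e where e: "e \<in> edges H" "ends H e = {x, y}" using assms by (auto simp: adjacent_def)
  show thesis
  proof (cases "e \<in> edges G")
    case True
    then show thesis using e that(1) by (auto simp: adjacent_def ends_old)
  next
    case False
    then obtain l e' where e': "l \<in> L" "e' \<in> edges S" "e = Copy_Edge n l e'"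
      using e by (auto simp: edges_H)
    obtain a b where ab: "ends S e' = {a, b}" using seed_edge_ends[OF e'(2)] .
    \<comment> \<open>The equality fixes the endpoints only up to order; symmetry of adjacency
      covers the swapped case.\<close>
    then have "{fuse h n l a, fuse h n l b} = {x, y}" using e e' by (simp add: ends_copy)
    moreover have "adjacent S a b" using e'(2) ab by (auto simp: adjacent_def)
    ultimately show thesis
      using that(2)[OF e'(1)] adjacent_sym[of S a b] by (metis doubleton_eq_iff)
  qed
qed

lemma retract_reaches:
  assumes "x \<in> verts H"
  shows "(adjacent H)\<^sup>*\<^sup>* (retract x) x \<and> retract x \<in> verts G"
  using assms
proof (cases rule: verts_H_cases)
  case (2 l v)
  have "(adjacent H ^^ gdist S h v) (fuse h n l h) (fuse h n l v)"
    using relpowp_map[of "adjacent S" "adjacent H" "fuse h n l"] adjacent_fuse[OF 2(1)]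
      S.relpowp_gdist[OF hook 2(2)] by blast
  then show ?thesis
    using 2(1,3) latch_verts[OF 2(1)] by (simp add: fuse_def[of h n l h] relpowp_imp_rtranclp)
qed simp

text \<open>Walk from \<open>u\<close> to its retract, through the old network, and out again to
  \<open>v\<close>.\<close>

lemma connected_graph_H: "connected_graph H"
proof (rule connected_graphI)
  show "verts H \<noteq> {}" using G.verts_nonempty by (auto simp: verts_H)
  fix u v assume uv: "u \<in> verts H" "v \<in> verts H"
  have "symp (adjacent H)" by (blast intro: sympI adjacent_sym)
  then have "(adjacent H)\<^sup>*\<^sup>* u (retract u)"
    using retract_reaches[OF uv(1)] by (meson symp_rtranclp sympD)
  also have "(adjacent G)\<^sup>*\<^sup>* (retract u) (retract v)"
    using retract_reaches uv by (blast intro: relpowp_imp_rtranclp G.relpowp_gdist)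
  then have "(adjacent H)\<^sup>*\<^sup>* (retract u) (retract v)"
    by (rule rtranclp_mono[THEN predicate2D, rotated]) (auto intro: adjacent_old)
  also have "(adjacent H)\<^sup>*\<^sup>* (retract v) v" using retract_reaches uv by blast
  finally show "(adjacent H)\<^sup>*\<^sup>* u v" .
qed (fact finite_mgraph_H)

sublocale H: connected_graph H
  by (rule connected_graph_H)

section \<open>Exact distances in the hooked network\<close>

lemma old_in_H: "x \<in> verts G \<Longrightarrow> x \<in> verts H"
  by (simp add: verts_H)

lemma fuse_in_H: "l \<in> L \<Longrightarrow> v \<in> verts S \<Longrightarrow> fuse h n l v \<in> verts H"
  by (auto simp: verts_H)

lemma gdist_old_le: "u \<in> verts G \<Longrightarrow> v \<in> verts G \<Longrightarrow> gdist H u v \<le> gdist G u v"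
  using G.gdist_hom_le[OF finite_mgraph_H, of id] by (auto simp: verts_H adjacent_old)

lemma gdist_fuse_le:
  "l \<in> L \<Longrightarrow> u \<in> verts S \<Longrightarrow> v \<in> verts S \<Longrightarrow>
    gdist H (fuse h n l u) (fuse h n l v) \<le> gdist S u v"
  using S.gdist_hom_le[OF finite_mgraph_H, of "fuse h n l"] by (auto simp: verts_H adjacent_fuse)

lemma gdist_latch_le:
  "l \<in> L \<Longrightarrow> v \<in> verts S \<Longrightarrow> gdist H l (fuse h n l v) \<le> gdist S h v"
  using gdist_fuse_le[of l h v] hook by (simp add: fuse_def)

lemma gdist_old_copy_le:
  assumes "u \<in> verts G" "l \<in> L" "v \<in> verts S"
  shows "gdist H u (fuse h n l v) \<le> gdist G u l + gdist S h v"
  using H.gdist_triangle[of u l "fuse h n l v"] gdist_old_le[of u l] gdist_latch_le[of l v]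
    assms latch_verts old_in_H fuse_in_H by fastforce

lemma gdist_copies_le:
  assumes "l \<in> L" "v \<in> verts S" "l' \<in> L" "v' \<in> verts S"
  shows "gdist H (fuse h n l v) (fuse h n l' v') \<le> gdist S h v + gdist G l l' + gdist S h v'"
  using H.gdist_triangle[of "fuse h n l v" l "fuse h n l' v'"]
    H.gdist_sym[of "fuse h n l v" l] gdist_old_copy_le[of l l' v'] gdist_latch_le[of l v]
    assms latch_verts old_in_H fuse_in_H by fastforce

text \<open>The sign \<open>\<sigma> l\<close> says whether the potential increases or decreases inside the copy at \<open>l\<close>.\<close>

lemma signed_depth_lipschitz:
  fixes \<sigma> :: "'v vertex \<Rightarrow> int"
  assumes \<sigma>: "\<And>l. \<bar>\<sigma> l\<bar> = 1" and w: "w \<in> verts G" and uv: "u \<in> verts H" "v \<in> verts H"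
  defines "\<phi> \<equiv> \<lambda>x. int (gdist G w (retract x)) + \<sigma> (retract x) * int (depth x)"
  shows "\<phi> v \<le> \<phi> u + int (gdist H u v)"
proof (rule H.gdist_lipschitz[OF _ uv])
  fix x y assume "adjacent H x y"
  then show "\<phi> y \<le> \<phi> x + 1"
  proof (cases rule: adjacent_H_cases)
    \<comment> \<open>Old endpoints have depth 0, so only the distance from \<open>w\<close>
      varies.\<close>
    case 1
    then show ?thesis
      using G.adjacent_verts[OF 1] G.gdist_edge_diff[OF 1 w] by (simp add: \<phi>_def)
  next
    \<comment> \<open>Both endpoints retract to \<open>l\<close>, so only the signed depth
      varies.\<close>
    case (2 l a b)
    have "\<sigma> l = 1 \<or> \<sigma> l = -1" using \<sigma>[of l] by linarith
    then show ?thesis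
      using 2 S.gdist_edge_diff[OF 2(2) hook] by (auto simp: \<phi>_def)
  qed
qed

text \<open>The potential based at \<open>u\<close> with all signs positive is 0 at \<open>u\<close>
  and equals the left-hand side at the copied vertex.\<close>

lemma gdist_old_copy_ge:
  assumes "u \<in> verts G" "l \<in> L" "v \<in> verts S"
  shows "gdist G u l + gdist S h v \<le> gdist H u (fuse h n l v)"
  using signed_depth_lipschitz[of "\<lambda>_. 1" u u "fuse h n l v"] assms
  by (simp add: old_in_H fuse_in_H G.gdist_refl)

text \<open>Based at \<open>l\<close>, with negative sign there only, the potential climbs from
  \<open>- gdist S h v\<close> to \<open>gdist G l l' + gdist S h v'\<close>. Since
  \<open>l \<noteq> l'\<close>, the two copies can carry opposite signs.\<close>

lemma gdist_copies_ge:
  assumes "l \<in> L" "v \<in> verts S" "l' \<in> L" "v' \<in> verts S" "l \<noteq> l'"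
  shows "gdist S h v + gdist G l l' + gdist S h v' \<le> gdist H (fuse h n l v) (fuse h n l' v')"
proof -
  let ?\<sigma> = "\<lambda>x. if x = l then -1 else 1 :: int"
  have "\<bar>?\<sigma> x\<bar> = 1" for x by simp
  from signed_depth_lipschitz[of ?\<sigma> l "fuse h n l v" "fuse h n l' v'", OF this] show ?thesis
    using assms by (simp add: latch_verts fuse_in_H G.gdist_refl)
qed

text \<open>Copies create no shortcuts: on old vertices the potential is just the old distance from
  \<open>u\<close>.\<close>

lemma gdist_old:
  assumes "u \<in> verts G" "v \<in> verts G"
  shows "gdist H u v = gdist G u v"
  using signed_depth_lipschitz[of "\<lambda>_. 1" u u v] gdist_old_le[OF assms] assms
  by (simp add: old_in_H G.gdist_refl)

lemma diameter_old_le: "graph_diameter G \<le> graph_diameter H"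
  using H.gdist_le_diameter by (intro G.diameter_le) (metis gdist_old old_in_H)

section \<open>Extremal latches and the diameter after one step\<close>

lemma gdist_le_latch_distance: "l \<in> L \<Longrightarrow> l' \<in> L \<Longrightarrow> gdist G l l' \<le> latch_distance G L"
  unfolding latch_distance_def by (rule Max_ge) (auto simp: finite_L finite_image_set2)

text \<open>The maximum defining \<open>latch_distance\<close> also ranges over pairs
  \<open>l = l'\<close>, whereas \<open>gdist_copies_ge\<close> asks for distinct latches.\<close>

lemma latch_distance_attained:
  assumes "card L > 1"
  obtains l l' where "l \<in> L" "l' \<in> L" "l \<noteq> l'" "latch_distance G L = gdist G l l'"
proof -
  obtain a b where ab: "a \<in> L" "b \<in> L" "a \<noteq> b"
    using assms by (metis card_le_Suc0_iff_eq finite_L not_le One_nat_def)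
  have "latch_distance G L \<in> {gdist G l l' | l l'. l \<in> L \<and> l' \<in> L}"
    unfolding latch_distance_def using ab
    by (intro Max_in) (auto simp: finite_L finite_image_set2)
  then obtain l l' where l: "l \<in> L" "l' \<in> L" "latch_distance G L = gdist G l l'" by auto
  show thesis
  proof (cases "l = l'")
    \<comment> \<open>A maximum attained on the diagonal is 0, so the distinct pair
      \<open>a\<close>, \<open>b\<close> attains it too.\<close>
    case True
    then have "latch_distance G L = 0" using l G.gdist_refl latch_verts by simp
    then show thesis using that[OF ab] gdist_le_latch_distance[OF ab(1,2)] by simp
  qed (use l that in blast)
qed

lemma eccentricity_le_latch_eccentricity:
  "l \<in> L \<Longrightarrow> eccentricity G l \<le> latch_eccentricity G L"
  unfolding latch_eccentricity_def by (rule Max_ge) (auto simp: finite_L)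

text \<open>The three terms account for two old vertices, vertices in copies at distinct latches,
  and an old vertex paired with a copied one. Two vertices of one copy fall under the first term by
  the assumption \<open>seed\<close>.\<close>

lemma diameter_hook_step:
  assumes L: "L \<noteq> {}" and seed: "graph_diameter S \<le> graph_diameter G"
  shows "graph_diameter H =
    Max {graph_diameter G,
         (2 * eccentricity S h + latch_distance G L) * of_bool (card L > 1),
         eccentricity S h + latch_eccentricity G L}" (is "_ = Max {?D, ?Q, ?A}")
proof (rule antisym)
  have old_copy: "gdist H u (fuse h n l v) \<le> ?A"
    if "u \<in> verts G" "l \<in> L" "v \<in> verts S" for u l v
    using gdist_old_copy_le[OF that] G.gdist_sym[OF that(1) latch_verts[OF that(2)]]
      G.gdist_le_eccentricity[OF that(1), of l] S.gdist_le_eccentricity[OF that(3), of h]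
      eccentricity_le_latch_eccentricity[OF that(2)] by linarith
  have copies: "gdist H (fuse h n l v) (fuse h n l' v') \<le> max ?D ?Q"
    if "l \<in> L" "v \<in> verts S" "l' \<in> L" "v' \<in> verts S" for l v l' v'
  proof (cases "l = l'")
    case True
    then have "gdist H (fuse h n l v) (fuse h n l' v') \<le> ?D"
      using gdist_fuse_le[OF that(1,2,4)] S.gdist_le_diameter[OF that(2,4)] seed by simp
    then show ?thesis by simp
  next
    case False
    have "card L > 1"
      using False that finite_L by (metis card_le_Suc0_iff_eq not_le One_nat_def)
    then have "gdist H (fuse h n l v) (fuse h n l' v') \<le> ?Q"
      using gdist_copies_le[OF that] gdist_le_latch_distance[OF that(1,3)]
        S.gdist_le_eccentricity[OF that(2), of h] S.gdist_le_eccentricity[OF that(4), of h]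
      by simp
    then show ?thesis by simp
  qed
  show "graph_diameter H \<le> Max {?D, ?Q, ?A}"
  proof (rule H.diameter_le)
    fix u v assume uv: "u \<in> verts H" "v \<in> verts H"
    have "gdist H u v \<le> max ?D (max ?Q ?A)"
      using uv(1)
    proof (cases rule: verts_H_cases)
      case u: 1
      show ?thesis
        using uv(2)
      proof (cases rule: verts_H_cases)
        case 1
        then show ?thesis using gdist_old G.gdist_le_diameter u by (simp add: le_max_iff_disj)
      next
        case 2
        then show ?thesis using old_copy u by (simp add: le_max_iff_disj)
      qed
    next
      case u: (2 l a)
      show ?thesis
        using uv(2)
      proof (cases rule: verts_H_cases)
        case 1
        then show ?thesis
          using old_copy[OF 1 u(1,2)] u H.gdist_sym[OF uv] by (simp add: le_max_iff_disj)
      next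
        case (2 l' b)
        show ?thesis
          using copies[OF u(1,2) 2(1,2)] unfolding u(3) 2(3) le_max_iff_disj by blast
      qed
    qed
    then show "gdist H u v \<le> Max {?D, ?Q, ?A}" by simp
  qed
next
  \<comment> \<open>The images of a vertex farthest from the hook make the bounds for the second and
    third terms sharp.\<close>
  obtain v where v: "v \<in> verts S" "eccentricity S h = gdist S h v"
    using S.eccentricity_attained by blast
  have "?Q \<le> graph_diameter H"
  proof (cases "card L > 1")
    case True
    obtain l l' where l: "l \<in> L" "l' \<in> L" "l \<noteq> l'" "latch_distance G L = gdist G l l'"
      using latch_distance_attained[OF True] .
    show ?thesis
      using gdist_copies_ge[OF l(1) v(1) l(2) v(1) l(3)] True v(2) l(4)
        H.gdist_le_diameter[OF fuse_in_H[OF l(1) v(1)] fuse_in_H[OF l(2) v(1)]] by simp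
  qed simp
  moreover have "?A \<le> graph_diameter H"
  proof -
    have "latch_eccentricity G L \<in> eccentricity G ` L"
      unfolding latch_eccentricity_def using L finite_L by (intro Max_in) auto
    then obtain l where l: "l \<in> L" "latch_eccentricity G L = eccentricity G l" by auto
    \<comment> \<open>An old vertex farthest from a latch of largest eccentricity, to be paired with
      the image of \<open>v\<close> in the copy at that latch.\<close>
    obtain u where u: "u \<in> verts G" "eccentricity G l = gdist G l u"
      using G.eccentricity_attained by blast
    show ?thesis
      using gdist_old_copy_ge[OF u(1) l(1) v(1)] G.gdist_sym[OF u(1) latch_verts[OF l(1)]]
        H.gdist_le_diameter[OF old_in_H[OF u(1)] fuse_in_H[OF l(1) v(1)]] v(2) l(2) u(2)
      by simp
  qed
  ultimately show "Max {?D, ?Q, ?A} \<le> graph_diameter H" using diameter_old_le by simp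
qed

lemma vertex_age_H: "x \<in> verts H \<Longrightarrow> vertex_age x \<le> n"
  using vertex_age latch_verts by (force simp: verts_H fuse_def)

lemma edge_age_H: "e \<in> edges H \<Longrightarrow> edge_age e \<le> n"
  using edge_age by (force simp: edges_H)

end

section \<open>The random network\<close>

lemma adjacent_initial_network:
  "adjacent (initial_network S) x y \<longleftrightarrow>
    (\<exists>a b. adjacent S a b \<and> x = Seed_Vertex a \<and> y = Seed_Vertex b)"
proof
  assume "adjacent (initial_network S) x y"
  then obtain e where e: "e \<in> edges S" "Seed_Vertex ` ends S e = {x, y}"
    by (auto simp: adjacent_def initial_network_def)
  then obtain a b where ab: "x = Seed_Vertex a" "y = Seed_Vertex b" by blast
  have "Seed_Vertex ` ends S e = Seed_Vertex ` {a, b}" using e ab by simp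
  then have "ends S e = {a, b}" by (subst (asm) inj_image_eq_iff) (auto simp: inj_def)
  then show "\<exists>a b. adjacent S a b \<and> x = Seed_Vertex a \<and> y = Seed_Vertex b"
    using e(1) ab by (auto simp: adjacent_def)
qed (fastforce simp: adjacent_def initial_network_def)

context connected_graph
begin

lemma connected_graph_initial_network: "connected_graph (initial_network G)"
proof (rule connected_graphI)
  have "card (Seed_Vertex ` A) = card A" for A :: "'v set"
    by (rule card_image) (simp add: inj_on_def)
  then show "finite_mgraph (initial_network G)"
    using finite_mgraph by (fastforce simp: finite_mgraph_def initial_network_def)
  show "verts (initial_network G) \<noteq> {}" using verts_nonempty by (simp add: initial_network_def)
  fix u v assume "u \<in> verts (initial_network G)" "v \<in> verts (initial_network G)"
  then obtain a b where "a \<in> verts G" "u = Seed_Vertex a" "b \<in> verts G" "v = Seed_Vertex b"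
    by (auto simp: initial_network_def)
  then show "(adjacent (initial_network G))\<^sup>*\<^sup>* u v"
    using relpowp_imp_rtranclp[OF relpowp_map[OF _ relpowp_gdist]] adjacent_initial_network
    by metis
qed

text \<open>Base case of the diameter bound that \<open>diameter_hook_step\<close> assumes.\<close>

lemma diameter_initial_network: "graph_diameter G \<le> graph_diameter (initial_network G)"
proof (rule diameter_le)
  fix u v assume uv: "u \<in> verts G" "v \<in> verts G"
  interpret I: connected_graph "initial_network G" by (rule connected_graph_initial_network)
  have uv': "Seed_Vertex u \<in> verts (initial_network G)" "Seed_Vertex v \<in> verts (initial_network G)"
    using uv by (auto simp: initial_network_def)
  \<comment> \<open>\<open>case_vertex id undefined\<close> strips the label
    \<open>Seed_Vertex\<close>; its undefined branch is never reached, as the initial network has no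
    copy vertices.\<close>
  have "gdist G (case_vertex id undefined (Seed_Vertex u)) (case_vertex id undefined (Seed_Vertex v))
      \<le> gdist (initial_network G) (Seed_Vertex u) (Seed_Vertex v)"
    by (rule I.gdist_hom_le[OF finite_mgraph _ _ uv'])
      (auto simp: adjacent_initial_network, auto simp: initial_network_def)
  then show "gdist G u v \<le> graph_diameter (initial_network G)"
    using I.gdist_le_diameter[OF uv'] by simp
qed

end

lemma set_pmf_uniform_latches:
  assumes "finite (verts (grow S h Ls))" "k n \<le> card (verts (grow S h Ls))"
  shows "set_pmf (pmf_of_set {L. L \<subseteq> verts (grow S h Ls) \<and> card L = k n}) =
    {L. L \<subseteq> verts (grow S h Ls) \<and> card L = k n}"
proof (rule set_pmf_of_set)
  show "{L. L \<subseteq> verts (grow S h Ls) \<and> card L = k n} \<noteq> {}"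
    using obtain_subset_with_card_n[OF assms(2)] by blast
qed (use assms(1) in simp)

section \<open>Invariants along the random history\<close>

locale multi_hooking =
  fixes S :: "('v, 'e) mgraph" and h :: 'v and k :: "nat \<Rightarrow> nat"
  assumes seed: "seed S h" and building_sequence: "building_sequence (card (verts S)) k"
begin

sublocale S: connected_graph S
  using seed by unfold_locales (auto simp: seed_def)

text \<open>The length fixes the stamp of the next copies, the ages make them fresh, the vertex
  count ensures that enough latches exist, and the last conjunct absorbs distances within one
  copy.\<close>

definition history_invariant :: "nat \<Rightarrow> 'v vertex set list \<Rightarrow> bool" where
  "history_invariant n Ls \<longleftrightarrow> length Ls = n \<and> connected_graph (grow S h Ls) \<and>
     (\<forall>x\<in>verts (grow S h Ls). vertex_age x \<le> n) \<and> (\<forall>e\<in>edges (grow S h Ls). edge_age e \<le> n) \<and>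
     card (verts (grow S h Ls)) = card (verts S) + (card (verts S) - 1) * (\<Sum>i<n. k i) \<and>
     graph_diameter S \<le> graph_diameter (grow S h Ls)"

text \<open>The premise \<open>inv\<close> has the form of an induction hypothesis, so the lemma
  serves both in the proof of \<open>history_invariant\<close> and after it.\<close>

lemma latch_history_SucD:
  assumes "Ls' \<in> set_pmf (latch_history S h k (Suc n))"
    and inv: "\<And>Ls. Ls \<in> set_pmf (latch_history S h k n) \<Longrightarrow> history_invariant n Ls"
  obtains L Ls where "Ls' = L # Ls" "history_invariant n Ls" "L \<subseteq> verts (grow S h Ls)"
    "card L = k n" "L \<noteq> {}" "hooking S (grow S h Ls) h (Suc n) L"
proof -
  obtain Ls where Ls: "Ls \<in> set_pmf (latch_history S h k n)"
    "Ls' \<in> (\<lambda>L. L # Ls) ` set_pmf (pmf_of_set {L. L \<subseteq> verts (grow S h Ls) \<and> card L = k n})"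
    using assms(1) by auto
  have I: "history_invariant n Ls" using inv Ls(1) .
  then interpret G: connected_graph "grow S h Ls" by (simp add: history_invariant_def)
  have "k n \<le> card (verts (grow S h Ls))"
    using I building_sequence by (simp add: history_invariant_def building_sequence_def)
  then obtain L where L: "Ls' = L # Ls" "L \<subseteq> verts (grow S h Ls)" "card L = k n"
    using Ls(2) by (auto simp: set_pmf_uniform_latches)
  have "k n \<ge> 1" using building_sequence by (simp add: building_sequence_def)
  then have "L \<noteq> {}" using L(3) by auto
  moreover have "hooking S (grow S h Ls) h (Suc n) L"
    by unfold_locales
      (use I L(2) seed in \<open>auto simp: history_invariant_def seed_def less_Suc_eq_le\<close>)
  ultimately show thesis using that L I by blast
qed

lemma history_invariant: "Ls \<in> set_pmf (latch_history S h k n) \<Longrightarrow> history_invariant n Ls"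
proof (induction n arbitrary: Ls)
  case 0
  have "card (verts (initial_network S)) = card (verts S)"
    by (simp add: initial_network_def card_image inj_on_def)
  then show ?case
    using 0 S.connected_graph_initial_network S.diameter_initial_network
    by (auto simp: history_invariant_def) (auto simp: initial_network_def)
next
  case (Suc n)
  obtain L Ls' where L: "Ls = L # Ls'" "history_invariant n Ls'" "card L = k n"
    "hooking S (grow S h Ls') h (Suc n) L"
    using latch_history_SucD[OF Suc.prems Suc.IH] by metis
  interpret hooking S "grow S h Ls'" h "Suc n" L by (rule L(4))
  show ?case
    using L(1-3) H.connected_graph_axioms vertex_age_H edge_age_H card_verts_H diameter_old_le
    by (auto simp: history_invariant_def algebra_simps)
qed

text \<open>The right-hand side depends on the history only through \<open>G\<close> and
  \<open>L\<close>. The indicator may be stated with \<open>k (n - 1)\<close> because that is the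
  number of latches drawn in the last step.\<close>

lemma diameter_grow:
  assumes "Ls \<in> set_pmf (latch_history S h k n)" "n \<ge> 1"
    and G: "grow S h (tl Ls) = G" and L: "hd Ls = L"
  shows "graph_diameter (grow S h Ls) =
    Max {graph_diameter G,
         (2 * eccentricity S h + latch_distance G L) * of_bool (k (n - 1) > 1),
         eccentricity S h + latch_eccentricity G L}"
proof -
  have n: "n = Suc (n - 1)" using assms(2) by simp
  obtain L' Ls' where Ls: "Ls = L' # Ls'" "history_invariant (n - 1) Ls'" "card L' = k (n - 1)"
    "L' \<noteq> {}" "hooking S (grow S h Ls') h n L'"
    using latch_history_SucD[of Ls "n - 1"] assms(1) history_invariant n by metis
  interpret hooking S "grow S h Ls'" h n L' by (rule Ls(5))
  have "grow S h Ls = H" using Ls(1,2) n by (simp add: history_invariant_def)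
  then show ?thesis
    using diameter_hook_step[OF Ls(4)] Ls(1-3) G L by (simp add: history_invariant_def)
qed

end

theorem theorem7p1:
  fixes S :: "('v, 'e) mgraph" and h :: 'v and k :: "nat \<Rightarrow> nat" and n :: nat
    and G :: "('v, 'e) network" and L :: "'v vertex set"
  assumes "seed S h"
    and "building_sequence (card (verts S)) k"
    and "n \<ge> 1"
    and "(G, L) \<in> set_pmf (past_law S h k n)"
  shows "conditional_diameter S h k n G L =
    return_pmf (Max {graph_diameter G,
                     (2 * eccentricity S h + latch_distance G L) * of_bool (k (n - 1) > 1),
                     eccentricity S h + latch_eccentricity G L})"
proof -
  interpret multi_hooking S h k using assms(1,2) by unfold_locales
  let ?A = "{Ls. grow S h (tl Ls) = G \<and> hd Ls = L}"
  let ?M = "Max {graph_diameter G,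
                 (2 * eccentricity S h + latch_distance G L) * of_bool (k (n - 1) > 1),
                 eccentricity S h + latch_eccentricity G L}"
  \<comment> \<open>The conditioning event has positive probability, which \<open>cond_pmf\<close>
    requires.\<close>
  have "set_pmf (latch_history S h k n) \<inter> ?A \<noteq> {}"
    using assms(4) by (auto simp: past_law_def)
  then have "set_pmf (cond_pmf (latch_history S h k n) ?A) = set_pmf (latch_history S h k n) \<inter> ?A"
    by (rule set_cond_pmf)
  \<comment> \<open>On the support of the conditional law the diameter is constant, so its law is a
    point mass.\<close>
  then have "conditional_diameter S h k n G L =
      map_pmf (\<lambda>_. ?M) (cond_pmf (latch_history S h k n) ?A)"
    unfolding conditional_diameter_def using diameter_grow assms(3)
    by (intro map_pmf_cong) auto
  then show ?thesis by simp
qed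

end
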